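(* Let $R$ be a unital hom-associative ring with twisting map $\alpha$, let $\sigma\colon R\to R$ be an automorphism and let $\delta\colon R\to R$ be a $\sigma$-derivation, such that both $\sigma$ and $\delta$ commute with $\alpha$ (i.e. $\sigma\circ\alpha=\alpha\circ\sigma$ and $\delta\circ\alpha=\alpha\circ\delta$). Extend $\alpha$ homogeneously to $R[X;\sigma,\delta]$. If $R$ is right Noetherian, then $R[X;\sigma,\delta]$ is right Noetherian; and if $R$ is left Noetherian, then $R[X;\sigma,\delta]$ is left Noetherian.
   Context: "Non-associative" means not necessarily associative. A non-associative ring is an abelian group with a biadditive multiplication; it is unital if there is an element $1$ with $1\cdot a=a\cdot 1=a$ for all $a$. A hom-associative ring is a non-associative ring $R$ together with an additive map $\alpha\colon R\to R$ (the twisting map; not assumed multiplicative) satisfying $\alpha(a)\cdot(b\cdot c)=(a\cdot b)\cdot\alpha(c)$ for all $a,b,c\in R$. An endomorphism of $R$ is an additive, multiplicative map $R\to R$; it is unital if it maps $1$ to $1$; an automorphism is a bijective endomorphism. For a unital endomorphism $\sigma$, a $\sigma$-derivation is an additive map $\delta\colon R\to R$ with $\delta(a\cdot b)=\sigma(a)\cdot\delta(b)+\delta(a)\cdot b$ for all $a,b\in R$. The unital, non-associative Ore extension $R[X;\sigma,\delta]$ is the set of formal sums $\sum_{i\in\mathbb{N}}a_iX^i$ ($\mathbb{N}=\{0,1,2,\dots\}$) with finitely many nonzero $a_i\in R$, with coefficientwise equality and addition, and with multiplication the biadditive extension of $aX^m\cdot bX^n=\sum_{i\in\mathbb{N}}(a\cdot\pi_i^m(b))X^{i+n}$,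 where $\pi_i^m\colon R\to R$ is the sum of all $\binom{m}{i}$ compositions of $i$ copies of $\sigma$ and $m-i$ copies of $\delta$ in arbitrary order, $\pi_0^0=\mathrm{id}_R$, and $\pi_i^m=0$ if $i<0$ or $i>m$. The homogeneous extension of $\alpha$ is $\alpha\left(\sum_i a_iX^i\right):=\sum_i\alpha(a_i)X^i$. A right (left) ideal of a non-associative ring $S$ is an additive subgroup $I$ with $i\cdot s\in I$ ($s\cdot i\in I$) for all $i\in I$, $s\in S$. $S$ is right (left) Noetherian if it satisfies the ascending chain condition on right (left) ideals. *)

theory Defs
  imports "HOL-Computational_Algebra.Polynomial"
begin

text \<open>
  The additive group of a ring is a type of class \<^class>\<open>ab_group_add\<close>. Multiplication,
  identity element and twisting map are explicit data, since the library's multiplicative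
  type classes all presuppose associativity.
\<close>

record 'a hom_ring =
  rmult :: "'a \<Rightarrow> 'a \<Rightarrow> 'a"
  rone :: 'a
  twist :: "'a \<Rightarrow> 'a"

definition nonassoc_ring :: "('a::ab_group_add, 'm) hom_ring_scheme \<Rightarrow> bool" where
  "nonassoc_ring R \<longleftrightarrow>
     (\<forall>a. Modules.additive (\<lambda>b. rmult R a b)) \<and> (\<forall>b. Modules.additive (\<lambda>a. rmult R a b))"

definition unital_ring :: "('a::ab_group_add, 'm) hom_ring_scheme \<Rightarrow> bool" where
  "unital_ring R \<longleftrightarrow>
     nonassoc_ring R \<and> (\<forall>a. rmult R (rone R) a = a \<and> rmult R a (rone R) = a)"

definition hom_assoc_ring :: "('a::ab_group_add, 'm) hom_ring_scheme \<Rightarrow> bool" where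
  "hom_assoc_ring R \<longleftrightarrow>
     nonassoc_ring R \<and> Modules.additive (twist R) \<and>
     (\<forall>a b c. rmult R (twist R a) (rmult R b c) = rmult R (rmult R a b) (twist R c))"

definition ring_endomorphism ::
    "('a::ab_group_add, 'm) hom_ring_scheme \<Rightarrow> ('a \<Rightarrow> 'a) \<Rightarrow> bool" where
  "ring_endomorphism R \<sigma> \<longleftrightarrow>
     Modules.additive \<sigma> \<and> (\<forall>a b. \<sigma> (rmult R a b) = rmult R (\<sigma> a) (\<sigma> b))"

text \<open>
  Preservation of the identity element need not be required here: a surjective
  multiplicative map sends it to an identity element.
\<close>

definition ring_automorphism ::
    "('a::ab_group_add, 'm) hom_ring_scheme \<Rightarrow> ('a \<Rightarrow> 'a) \<Rightarrow> bool" where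
  "ring_automorphism R \<sigma> \<longleftrightarrow> ring_endomorphism R \<sigma> \<and> bij \<sigma>"

lemma ring_automorphism_one:
  assumes "unital_ring R" and "ring_automorphism R \<sigma>"
  shows "\<sigma> (rone R) = rone R"
proof -
  obtain e where e: "\<sigma> e = rone R"
    using assms(2) unfolding ring_automorphism_def by (metis bij_pointE)
  have "\<sigma> e = rmult R (\<sigma> (rone R)) (\<sigma> e)"
    using assms unfolding ring_automorphism_def ring_endomorphism_def unital_ring_def by metis
  then show ?thesis
    using e assms(1) unfolding unital_ring_def by simp
qed

definition skew_derivation ::
    "('a::ab_group_add, 'm) hom_ring_scheme \<Rightarrow> ('a \<Rightarrow> 'a) \<Rightarrow> ('a \<Rightarrow> 'a) \<Rightarrow> bool" where
  "skew_derivation R \<sigma> \<delta> \<longleftrightarrow>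
     Modules.additive \<delta> \<and> (\<forall>a b. \<delta> (rmult R a b) = rmult R (\<sigma> a) (\<delta> b) + rmult R (\<delta> a) b)"

text \<open>
  A composition of \<open>m\<close> maps from \<open>{\<sigma>, \<delta>}\<close> is encoded by a word of length \<open>m\<close>, in which
  \<^const>\<open>True\<close> stands for \<open>\<sigma>\<close> and \<^const>\<open>False\<close> for \<open>\<delta>\<close>. Compositions are counted per word,
  also if some of them agree as maps.
\<close>

definition ore_pi ::
    "('a \<Rightarrow> 'a) \<Rightarrow> ('a \<Rightarrow> 'a) \<Rightarrow> nat \<Rightarrow> nat \<Rightarrow> 'a \<Rightarrow> 'a::ab_group_add" where
  "ore_pi \<sigma> \<delta> m i b =
     (\<Sum>w\<in>{w :: bool list. length w = m \<and> count_list w True = i}.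
        foldr (\<lambda>s. if s then \<sigma> else \<delta>) w b)"

text \<open>
  The formal sums are the elements of \<^typ>\<open>'a poly\<close>, of which only the additive structure is
  used; \<^term>\<open>monom a n\<close> is \<open>a X\<^sup>n\<close>.
\<close>

definition ore_mult ::
    "('a::ab_group_add, 'm) hom_ring_scheme \<Rightarrow> ('a \<Rightarrow> 'a) \<Rightarrow> ('a \<Rightarrow> 'a) \<Rightarrow>
     'a poly \<Rightarrow> 'a poly \<Rightarrow> 'a poly" where
  "ore_mult R \<sigma> \<delta> p q =
     (\<Sum>m\<le>degree p. \<Sum>n\<le>degree q. \<Sum>i\<le>m.
        monom (rmult R (coeff p m) (ore_pi \<sigma> \<delta> m i (coeff q n))) (i + n))"

text \<open>The twisting map below is the homogeneous extension of the one of \<open>R\<close>.\<close>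

definition ore_extension ::
    "('a::ab_group_add, 'm) hom_ring_scheme \<Rightarrow> ('a \<Rightarrow> 'a) \<Rightarrow> ('a \<Rightarrow> 'a) \<Rightarrow> 'a poly hom_ring" where
  "ore_extension R \<sigma> \<delta> =
     \<lparr>rmult = ore_mult R \<sigma> \<delta>, rone = monom (rone R) 0, twist = map_poly (twist R)\<rparr>"

definition additive_subgroup :: "'a::ab_group_add set \<Rightarrow> bool" where
  "additive_subgroup I \<longleftrightarrow> 0 \<in> I \<and> (\<forall>x\<in>I. \<forall>y\<in>I. x + y \<in> I) \<and> (\<forall>x\<in>I. - x \<in> I)"

definition right_ideal :: "('a::ab_group_add, 'm) hom_ring_scheme \<Rightarrow> 'a set \<Rightarrow> bool" where
  "right_ideal S I \<longleftrightarrow> additive_subgroup I \<and> (\<forall>i\<in>I. \<forall>s. rmult S i s \<in> I)"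

definition left_ideal :: "('a::ab_group_add, 'm) hom_ring_scheme \<Rightarrow> 'a set \<Rightarrow> bool" where
  "left_ideal S I \<longleftrightarrow> additive_subgroup I \<and> (\<forall>i\<in>I. \<forall>s. rmult S s i \<in> I)"

definition right_noetherian :: "('a::ab_group_add, 'm) hom_ring_scheme \<Rightarrow> bool" where
  "right_noetherian S \<longleftrightarrow>
     (\<forall>I :: nat \<Rightarrow> 'a set. (\<forall>n. right_ideal S (I n)) \<and> (\<forall>n. I n \<subseteq> I (Suc n)) \<longrightarrow>
        (\<exists>N. \<forall>n\<ge>N. I n = I N))"

definition left_noetherian :: "('a::ab_group_add, 'm) hom_ring_scheme \<Rightarrow> bool" where
  "left_noetherian S \<longleftrightarrow>
     (\<forall>I :: nat \<Rightarrow> 'a set. (\<forall>n. left_ideal S (I n)) \<and> (\<forall>n. I n \<subseteq> I (Suc n)) \<longrightarrow>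
        (\<exists>N. \<forall>n\<ge>N. I n = I N))"

text \<open>
  The multiplication is biadditive and given by the defining formula on monomials, in which the
  sum may stop at \<open>i = m\<close> because the terms with \<open>i > m\<close> vanish.
\<close>

lemma ore_pi_eq_0: "m < i \<Longrightarrow> ore_pi \<sigma> \<delta> m i b = 0"
  unfolding ore_pi_def
  by (rule sum.neutral) (use count_le_length[of _ True] in \<open>auto simp: not_le[symmetric]\<close>)

lemma ore_pi_additive:
  assumes "Modules.additive \<sigma>" and "Modules.additive \<delta>"
  shows "Modules.additive (ore_pi \<sigma> \<delta> m i)"
proof
  have "foldr (\<lambda>s. if s then \<sigma> else \<delta>) w (x + y) =
      foldr (\<lambda>s. if s then \<sigma> else \<delta>) w x + foldr (\<lambda>s. if s then \<sigma> else \<delta>) w y" for w x y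
    by (induction w) (auto simp: additive.add[OF assms(1)] additive.add[OF assms(2)])
  then show "ore_pi \<sigma> \<delta> m i (x + y) = ore_pi \<sigma> \<delta> m i x + ore_pi \<sigma> \<delta> m i y" for x y
    unfolding ore_pi_def by (simp add: sum.distrib)
qed

lemma ore_mult_bounded:
  assumes "nonassoc_ring R" and "Modules.additive \<sigma>" and "Modules.additive \<delta>"
    and "degree p \<le> M" and "degree q \<le> N"
  shows "ore_mult R \<sigma> \<delta> p q =
     (\<Sum>m\<le>M. \<Sum>n\<le>N. \<Sum>i\<le>m.
        monom (rmult R (coeff p m) (ore_pi \<sigma> \<delta> m i (coeff q n))) (i + n))"
proof -
  have l0: "rmult R 0 b = 0" and r0: "rmult R a 0 = 0" for a b
    using assms(1) additive.zero unfolding nonassoc_ring_def by blast+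
  have p0: "ore_pi \<sigma> \<delta> m i 0 = 0" for m i
    by (rule additive.zero[OF ore_pi_additive[OF assms(2,3)]])
  have inner: "(\<Sum>n\<le>N. \<Sum>i\<le>m. monom (rmult R a (ore_pi \<sigma> \<delta> m i (coeff q n))) (i + n)) =
      (\<Sum>n\<le>degree q. \<Sum>i\<le>m. monom (rmult R a (ore_pi \<sigma> \<delta> m i (coeff q n))) (i + n))" for a m
    by (rule sum.mono_neutral_right) (use assms(5) in \<open>auto simp: coeff_eq_0 p0 r0\<close>)
  show ?thesis
    unfolding ore_mult_def inner
    by (rule sum.mono_neutral_left) (use assms(4) in \<open>auto simp: coeff_eq_0 l0\<close>)
qed

lemma nonassoc_ring_ore_extension:
  assumes "nonassoc_ring R" and "Modules.additive \<sigma>" and "Modules.additive \<delta>"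
  shows "nonassoc_ring (ore_extension R \<sigma> \<delta>)"
proof -
  have ladd: "rmult R (a + a') b = rmult R a b + rmult R a' b"
    and radd: "rmult R a (b + b') = rmult R a b + rmult R a b'" for a a' b b'
    using assms(1) additive.add unfolding nonassoc_ring_def by blast+
  have padd: "ore_pi \<sigma> \<delta> m i (x + y) = ore_pi \<sigma> \<delta> m i x + ore_pi \<sigma> \<delta> m i y" for m i x y
    by (rule additive.add[OF ore_pi_additive[OF assms(2,3)]])
  have 1: "ore_mult R \<sigma> \<delta> p (q + q') = ore_mult R \<sigma> \<delta> p q + ore_mult R \<sigma> \<delta> p q'" for p q q'
  proof -
    let ?N = "max (degree q) (degree q')"
    have "degree (q + q') \<le> ?N"
      by (rule degree_add_le_max)
    then show ?thesis
      by (simp add: ore_mult_bounded[OF assms, of p "degree p" _ ?N]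
          padd radd add_monom[symmetric] sum.distrib)
  qed
  have 2: "ore_mult R \<sigma> \<delta> (p + p') q = ore_mult R \<sigma> \<delta> p q + ore_mult R \<sigma> \<delta> p' q" for p p' q
  proof -
    let ?M = "max (degree p) (degree p')"
    have "degree (p + p') \<le> ?M"
      by (rule degree_add_le_max)
    then show ?thesis
      by (simp add: ore_mult_bounded[OF assms, of _ ?M q "degree q"]
          ladd add_monom[symmetric] sum.distrib)
  qed
  show ?thesis
    unfolding nonassoc_ring_def ore_extension_def by (auto intro!: additive.intro simp: 1 2)
qed

lemma ore_mult_monom:
  assumes "nonassoc_ring R" and "Modules.additive \<sigma>" and "Modules.additive \<delta>"
  shows "ore_mult R \<sigma> \<delta> (monom a m) (monom b n) =
     (\<Sum>i\<le>m. monom (rmult R a (ore_pi \<sigma> \<delta> m i b)) (i + n))"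
proof -
  have l0: "rmult R 0 b = 0" and r0: "rmult R a 0 = 0" for a b
    using assms(1) additive.zero unfolding nonassoc_ring_def by blast+
  have p0: "ore_pi \<sigma> \<delta> m i 0 = 0" for m i
    by (rule additive.zero[OF ore_pi_additive[OF assms(2,3)]])
  have "ore_mult R \<sigma> \<delta> (monom a m) (monom b n) =
     (\<Sum>m'\<le>m. \<Sum>n'\<le>n. \<Sum>i\<le>m'. monom (rmult R (coeff (monom a m) m')
        (ore_pi \<sigma> \<delta> m' i (coeff (monom b n) n'))) (i + n'))"
    by (rule ore_mult_bounded[OF assms degree_monom_le degree_monom_le])
  also have "\<dots> = (\<Sum>m'\<in>{m}. \<Sum>n'\<le>n. \<Sum>i\<le>m'. monom (rmult R (coeff (monom a m) m')
        (ore_pi \<sigma> \<delta> m' i (coeff (monom b n) n'))) (i + n'))"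
    by (rule sum.mono_neutral_right) (auto simp: l0)
  also have "\<dots> = (\<Sum>n'\<le>n. \<Sum>i\<le>m. monom (rmult R a
        (ore_pi \<sigma> \<delta> m i (coeff (monom b n) n'))) (i + n'))"
    by simp
  also have "\<dots> = (\<Sum>n'\<in>{n}. \<Sum>i\<le>m. monom (rmult R a
        (ore_pi \<sigma> \<delta> m i (coeff (monom b n) n'))) (i + n'))"
    by (rule sum.mono_neutral_right) (auto simp: r0 p0)
  finally show ?thesis by simp
qed

lemma twist_ore_extension:
  "twist R 0 = 0 \<Longrightarrow> coeff (twist (ore_extension R \<sigma> \<delta>) p) i = twist R (coeff p i)"
  by (simp add: ore_extension_def coeff_map_poly)

end

(* A one-sided ideal of the Ore extension is determined, among the ideals containing it, by the
   additive groups L n of coefficients of X^n of its elements of degree at most n. The top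
   coefficient of a product is a sigma^m(b), where a and b are the top coefficients of the factors
   and m is the degree bound of the left one. As sigma is bijective, the L n of a right ideal are
   right ideals of R, and they increase with n through right multiplication by X. For a left ideal,
   left multiplication by X maps L n into L (n + 1) only up to sigma, so the sets L n are replaced
   by their preimages under sigma^n. A doubly indexed chain of ideals of R then becomes stationary
   uniformly in the degree. *)

theory Submission
  imports Defs
begin

text \<open>The diagonal \<open>A n n\<close> is itself an ascending chain, hence constant from some
  \<open>N\<close> on, and it controls all rows from \<open>N\<close> on at once. Only finitely many
  rows remain; each is stationary separately, so a maximum of their bounds is uniform.\<close>

lemma double_chain_stationary:
  fixes A :: "nat \<Rightarrow> nat \<Rightarrow> 'a set"
  assumes acc: "\<And>I :: nat \<Rightarrow> 'a set. (\<And>n. P (I n)) \<Longrightarrow> (\<And>n. I n \<subseteq> I (Suc n)) \<Longrightarrow>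
      \<exists>N. \<forall>n\<ge>N. I n = I N"
    and P: "\<And>n k. P (A n k)"
    and step1: "\<And>n k. A n k \<subseteq> A (Suc n) k"
    and step2: "\<And>n k. A n k \<subseteq> A n (Suc k)"
  shows "\<exists>K. \<forall>k\<ge>K. \<forall>n. A n k = A n K"
proof -
  have mono: "A n k \<subseteq> A n' k'" if "n \<le> n'" "k \<le> k'" for n k n' k'
    using lift_Suc_mono_le[of "\<lambda>n. A n k", OF step1 that(1)]
      lift_Suc_mono_le[of "\<lambda>k. A n' k", OF step2 that(2)] by (rule subset_trans)
  have "\<exists>N. \<forall>n\<ge>N. A n n = A N N"
    by (rule acc) (simp_all add: P mono)
  then obtain N where N: "\<And>n. n \<ge> N \<Longrightarrow> A n n = A N N"
    by blast
  have "\<exists>K. \<forall>k\<ge>K. A n k = A n K" for n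
    by (rule acc) (simp_all add: P mono)
  then obtain f where f: "\<And>n k. k \<ge> f n \<Longrightarrow> A n k = A n (f n)"
    by metis
  define K where "K = Max (insert N (f ` {..<N}))"
  have Kf: "f n \<le> K" if "n < N" for n
    using that by (simp add: K_def)
  have KN: "N \<le> K"
    by (simp add: K_def)
  have "A n k = A n K" if k: "K \<le> k" for n k
  proof (cases "n < N")
    case True
    then show ?thesis
      using f[of n k] f[of n K] Kf[OF True] k by simp
  next
    case False
    \<comment> \<open>The entry is squeezed between \<open>A N N\<close> and the diagonal entry at
      \<open>max n l\<close>, which equals \<open>A N N\<close> since \<open>max n l\<close> is at
      least \<open>N\<close>.\<close>
    have "A n l = A N N" if "K \<le> l" for l
    proof
      show "A n l \<subseteq> A N N"
        using mono[of n "max n l" l "max n l"] N[of "max n l"] False by simp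
      show "A N N \<subseteq> A n l"
        using False KN that by (intro mono) auto
    qed
    then show ?thesis
      using k by simp
  qed
  then show ?thesis
    by blast
qed

text \<open>The degree is only bounded by \<open>n\<close>: elements of smaller degree contribute 0,
  which makes the set closed under sums even when leading terms cancel.\<close>

definition top_coeffs :: "nat \<Rightarrow> 'a::ab_group_add poly set \<Rightarrow> 'a set" where
  "top_coeffs n J = {coeff p n | p. p \<in> J \<and> degree p \<le> n}"

lemma top_coeffsI: "p \<in> J \<Longrightarrow> degree p \<le> n \<Longrightarrow> coeff p n = a \<Longrightarrow> a \<in> top_coeffs n J"
  unfolding top_coeffs_def by blast

lemma top_coeffsE:
  assumes "a \<in> top_coeffs n J"
  obtains p where "p \<in> J" "degree p \<le> n" "coeff p n = a"
  using assms unfolding top_coeffs_def by blast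

lemma top_coeffs_mono: "J \<subseteq> J' \<Longrightarrow> top_coeffs n J \<subseteq> top_coeffs n J'"
  unfolding top_coeffs_def by blast

lemma additive_subgroup_top_coeffs:
  assumes "additive_subgroup J"
  shows "additive_subgroup (top_coeffs n J)"
  unfolding additive_subgroup_def
proof (intro conjI ballI)
  show "0 \<in> top_coeffs n J"
    using assms by (intro top_coeffsI[of 0]) (auto simp: additive_subgroup_def)
next
  fix a b
  assume "a \<in> top_coeffs n J" "b \<in> top_coeffs n J"
  then obtain p q where "p \<in> J" "degree p \<le> n" "coeff p n = a" "q \<in> J" "degree q \<le> n" "coeff q n = b"
    by (auto elim!: top_coeffsE)
  with assms show "a + b \<in> top_coeffs n J"
    by (intro top_coeffsI[of "p + q"]) (auto simp: additive_subgroup_def intro: degree_add_le)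
next
  fix a
  assume "a \<in> top_coeffs n J"
  then obtain p where "p \<in> J" "degree p \<le> n" "coeff p n = a"
    by (rule top_coeffsE)
  with assms show "- a \<in> top_coeffs n J"
    by (intro top_coeffsI[of "- p"]) (auto simp: additive_subgroup_def)
qed

text \<open>Cancellation of leading terms: subtracting from an element of \<open>J'\<close> an
  element of \<open>J\<close> with the same top coefficient lowers the degree, so induction
  applies.\<close>

lemma additive_subgroup_eqI:
  assumes J: "additive_subgroup J" and J': "additive_subgroup J'" and "J \<subseteq> J'"
    and top: "\<And>n. top_coeffs n J' = top_coeffs n J"
  shows "J' = J"
proof
  have diff: "p - q \<in> I" if "additive_subgroup I" "p \<in> I" "q \<in> I" for I and p q :: "'a poly"
    using that unfolding additive_subgroup_def by (metis diff_conv_add_uminus)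
  have add: "p + q \<in> J" if "p \<in> J" "q \<in> J" for p q
    using that J unfolding additive_subgroup_def by blast
  \<comment> \<open>The strict bound makes the base case vacuous.\<close>
  have main: "p \<in> J" if "p \<in> J'" "degree p < n" for p n
    using that
  proof (induction n arbitrary: p)
    case 0
    then show ?case by simp
  next
    case (Suc n)
    then have "coeff p n \<in> top_coeffs n J"
      unfolding top[symmetric] by (intro top_coeffsI[of p]) auto
    then obtain q where q: "q \<in> J" "degree q \<le> n" "coeff q n = coeff p n"
      by (rule top_coeffsE)
    have mem: "p - q \<in> J'"
      using Suc.prems q(1) \<open>J \<subseteq> J'\<close> by (intro diff[OF J']) auto
    have "degree (p - q) \<le> n"
      using Suc.prems q(2) by (intro degree_diff_le) auto
    show ?case
    proof (cases "degree (p - q) < n")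
      case True
      then show ?thesis
        using add[OF Suc.IH[OF mem True] q(1)] by simp
    next
      case False
      \<comment> \<open>The degree fails to drop only if the difference vanishes, which happens here
        for \<open>n = 0\<close>, as the zero polynomial has degree 0.\<close>
      then have "lead_coeff (p - q) = 0"
        using \<open>degree (p - q) \<le> n\<close> q(3) by (simp add: order.antisym)
      then have "p = q"
        by (simp only: leading_coeff_0_iff right_minus_eq)
      then show ?thesis
        using q(1) by simp
    qed
  qed
  then show "J' \<subseteq> J"
    by blast
qed fact

text \<open>This is the common core of both sides: \<open>P\<close> stands for being a right or left
  ideal of the coefficient ring, and \<open>h n\<close> is the identity for right ideals and
  \<open>\<sigma> ^^ n\<close> for left ideals.\<close>

lemma poly_chain_stationary:
  fixes J :: "nat \<Rightarrow> 'a::ab_group_add poly set" and h :: "nat \<Rightarrow> 'a \<Rightarrow> 'a"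
  assumes acc: "\<And>I :: nat \<Rightarrow> 'a set. (\<And>n. P (I n)) \<Longrightarrow> (\<And>n. I n \<subseteq> I (Suc n)) \<Longrightarrow>
      \<exists>N. \<forall>n\<ge>N. I n = I N"
    and J: "\<And>k. additive_subgroup (J k)" "\<And>k. J k \<subseteq> J (Suc k)"
    and h: "\<And>n. surj (h n)"
    and P: "\<And>n k. P (h n -` top_coeffs n (J k))"
    and step: "\<And>n k. h n -` top_coeffs n (J k) \<subseteq> h (Suc n) -` top_coeffs (Suc n) (J k)"
  shows "\<exists>K. \<forall>k\<ge>K. J k = J K"
proof -
  have "\<exists>K. \<forall>k\<ge>K. \<forall>n. h n -` top_coeffs n (J k) = h n -` top_coeffs n (J K)"
    by (rule double_chain_stationary[where P = P])
      (intro acc P step vimage_mono top_coeffs_mono J(2) | assumption)+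
  then obtain K where "\<And>k n. k \<ge> K \<Longrightarrow> h n -` top_coeffs n (J k) = h n -` top_coeffs n (J K)"
    by blast
  \<comment> \<open>A set is the image of its preimage under the surjection \<open>h n\<close>, so
    equal preimages give equal sets.\<close>
  then have K: "top_coeffs n (J k) = top_coeffs n (J K)" if "k \<ge> K" for k n
    using that surj_image_vimage_eq[OF h] by metis
  have "J k = J K" if "k \<ge> K" for k
    by (rule additive_subgroup_eqI[OF J(1) J(1) lift_Suc_mono_le[of J, OF J(2) that] K[OF that]])
  then show ?thesis
    by blast
qed

text \<open>Only the constant word \<open>replicate m True\<close> has as many letters
  \<open>True\<close> as its length, so the sum has a single term.\<close>

lemma ore_pi_diag: "ore_pi \<sigma> \<delta> m m b = (\<sigma> ^^ m) b"
proof -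
  have "w = replicate (length w) True" if "count_list w True = length w" for w
    using that
  proof (induction w)
    case (Cons x w)
    then show ?case
      using count_le_length[of w True] by (cases x) auto
  qed simp
  moreover have "count_list (replicate m True) True = m"
    by (induction m) auto
  ultimately have words: "{w. length w = m \<and> count_list w True = m} = {replicate m True}"
    by fastforce
  have "foldr (\<lambda>s. if s then \<sigma> else \<delta>) (replicate m True) b = (\<sigma> ^^ m) b"
    by (induction m) auto
  then show ?thesis
    unfolding ore_pi_def words by simp
qed

lemma degree_ore_mult_le:
  "degree (ore_mult R \<sigma> \<delta> p q) \<le> degree p + degree q"
  unfolding ore_mult_def
  by (intro degree_sum_le finite_atMost) (auto intro!: order.trans[OF degree_monom_le])

lemma coeff_ore_mult_top:
  assumes "nonassoc_ring R" and "Modules.additive \<sigma>" and "Modules.additive \<delta>"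
    and "degree p \<le> M" and "degree q \<le> N"
  shows "coeff (ore_mult R \<sigma> \<delta> p q) (M + N) = rmult R (coeff p M) ((\<sigma> ^^ M) (coeff q N))"
proof -
  let ?c = "\<lambda>m n i. rmult R (coeff p m) (ore_pi \<sigma> \<delta> m i (coeff q n))"
  have "coeff (ore_mult R \<sigma> \<delta> p q) (M + N) =
      (\<Sum>m\<le>M. \<Sum>n\<le>N. \<Sum>i\<le>m. if i + n = M + N then ?c m n i else 0)"
    by (simp add: ore_mult_bounded[OF assms] coeff_sum)
  \<comment> \<open>Since \<open>i \<le> m \<le> M\<close> and \<open>n \<le> N\<close>, the
    exponent \<open>i + n\<close> reaches \<open>M + N\<close> only if all these bounds are
    attained.\<close>
  also have "\<dots> = (\<Sum>m\<le>M. \<Sum>n\<le>N. \<Sum>i\<le>m. if i = M \<and> m = M \<and> n = N then ?c M N M else 0)"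
    by (intro sum.cong refl) auto
  also have "\<dots> = (\<Sum>m\<le>M. \<Sum>n\<le>N. if m = M \<and> n = N then ?c M N M else 0)"
    by (intro sum.cong refl) auto
  also have "\<dots> = (\<Sum>m\<le>M. if m = M then ?c M N M else 0)"
    by (intro sum.cong refl) auto
  also have "\<dots> = rmult R (coeff p M) ((\<sigma> ^^ M) (coeff q N))"
    by (simp add: ore_pi_diag)
  finally show ?thesis .
qed

text \<open>In both theorems one factor is a monomial: a constant yields closure under
  multiplication by the coefficient ring, and X yields the passage from \<open>n\<close> to
  \<open>Suc n\<close>.\<close>

lemma ore_mult_mem_top_coeffs:
  assumes "nonassoc_ring R" and "Modules.additive \<sigma>" and "Modules.additive \<delta>"
    and "degree p \<le> M" and "degree q \<le> N" and "ore_mult R \<sigma> \<delta> p q \<in> J"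
  shows "rmult R (coeff p M) ((\<sigma> ^^ M) (coeff q N)) \<in> top_coeffs (M + N) J"
  using assms
  by (intro top_coeffsI[OF assms(6)] order.trans[OF degree_ore_mult_le] add_mono coeff_ore_mult_top)

theorem right_noetherian_ore_extension:
  fixes R :: "('a::ab_group_add, 'm) hom_ring_scheme"
  assumes R: "unital_ring R" and \<sigma>: "ring_automorphism R \<sigma>" and \<delta>: "Modules.additive \<delta>"
    and noeth: "right_noetherian R"
  shows "right_noetherian (ore_extension R \<sigma> \<delta>)"
  unfolding right_noetherian_def
proof (intro allI impI, elim conjE)
  fix J
  assume "\<forall>k. right_ideal (ore_extension R \<sigma> \<delta>) (J k)" and chain: "\<forall>k. J k \<subseteq> J (Suc k)"
  then have sub: "additive_subgroup (J k)" and mult: "p \<in> J k \<Longrightarrow> ore_mult R \<sigma> \<delta> p q \<in> J k" for k p q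
    by (auto simp: right_ideal_def ore_extension_def)
  have ring: "nonassoc_ring R" "Modules.additive \<sigma>" "Modules.additive \<delta>" and "bij \<sigma>"
    using R \<sigma> \<delta> by (auto simp: unital_ring_def ring_automorphism_def ring_endomorphism_def)
  have pow_one: "(\<sigma> ^^ n) (rone R) = rone R" for n
    by (induction n) (simp_all add: ring_automorphism_one[OF R \<sigma>])
  show "\<exists>K. \<forall>k\<ge>K. J k = J K"
  proof (rule poly_chain_stationary[where P = "right_ideal R" and h = "\<lambda>n a. a"])
    show "\<exists>N. \<forall>n\<ge>N. I n = I N" if "\<And>n. right_ideal R (I n)" "\<And>n. I n \<subseteq> I (Suc n)" for I
      using noeth that unfolding right_noetherian_def by blast
    show "right_ideal R ((\<lambda>a. a) -` top_coeffs n (J k))" for n k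
      unfolding right_ideal_def vimage_ident
    proof (intro conjI ballI allI additive_subgroup_top_coeffs sub)
      fix a s
      assume "a \<in> top_coeffs n (J k)"
      then obtain p where p: "p \<in> J k" "degree p \<le> n" "coeff p n = a"
        by (rule top_coeffsE)
      \<comment> \<open>Moving a constant past \<open>n\<close> powers of X applies
        \<open>\<sigma> ^^ n\<close> to it, so the right factor must be the preimage of
        \<open>s\<close>.\<close>
      obtain r where "(\<sigma> ^^ n) r = s"
        using bij_fn[OF \<open>bij \<sigma>\<close>] by (metis bij_pointE)
      with ore_mult_mem_top_coeffs[OF ring p(2) degree_monom_le mult[OF p(1)], of r 0]
      show "rmult R a s \<in> top_coeffs n (J k)"
        by (simp add: p)
    qed
    show "(\<lambda>a. a) -` top_coeffs n (J k) \<subseteq> (\<lambda>a. a) -` top_coeffs (Suc n) (J k)" for n k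
      unfolding vimage_ident
    proof
      fix a
      assume "a \<in> top_coeffs n (J k)"
      then obtain p where p: "p \<in> J k" "degree p \<le> n" "coeff p n = a"
        by (rule top_coeffsE)
      \<comment> \<open>Right multiplication by X keeps the top coefficient, because
        \<open>\<sigma> ^^ n\<close> fixes the identity.\<close>
      from ore_mult_mem_top_coeffs[OF ring p(2) degree_monom_le mult[OF p(1)], of "rone R" 1]
      show "a \<in> top_coeffs (Suc n) (J k)"
        using R by (simp add: p pow_one unital_ring_def)
    qed
  qed (use sub chain in auto)
qed

theorem left_noetherian_ore_extension:
  fixes R :: "('a::ab_group_add, 'm) hom_ring_scheme"
  assumes R: "unital_ring R" and \<sigma>: "ring_automorphism R \<sigma>" and \<delta>: "Modules.additive \<delta>"
    and noeth: "left_noetherian R"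
  shows "left_noetherian (ore_extension R \<sigma> \<delta>)"
  unfolding left_noetherian_def
proof (intro allI impI, elim conjE)
  fix J
  assume "\<forall>k. left_ideal (ore_extension R \<sigma> \<delta>) (J k)" and chain: "\<forall>k. J k \<subseteq> J (Suc k)"
  then have sub: "additive_subgroup (J k)" and mult: "q \<in> J k \<Longrightarrow> ore_mult R \<sigma> \<delta> p q \<in> J k" for k p q
    by (auto simp: left_ideal_def ore_extension_def)
  have ring: "nonassoc_ring R" "Modules.additive \<sigma>" "Modules.additive \<delta>" and "bij \<sigma>"
    and hom: "\<And>a b. \<sigma> (rmult R a b) = rmult R (\<sigma> a) (\<sigma> b)"
    using R \<sigma> \<delta> by (auto simp: unital_ring_def ring_automorphism_def ring_endomorphism_def)
  have pow_mult: "(\<sigma> ^^ n) (rmult R a b) = rmult R ((\<sigma> ^^ n) a) ((\<sigma> ^^ n) b)" for n a b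
    by (induction n) (simp_all add: hom)
  have "Modules.additive (\<sigma> ^^ n)" for n
    by (rule additive.intro, induction n) (simp_all add: additive.add[OF ring(2)])
  note pow_add = additive.add[OF this] additive.zero[OF this] additive.minus[OF this]
  show "\<exists>K. \<forall>k\<ge>K. J k = J K"
  proof (rule poly_chain_stationary[where P = "left_ideal R" and h = "\<lambda>n. \<sigma> ^^ n"])
    show "\<exists>N. \<forall>n\<ge>N. I n = I N" if "\<And>n. left_ideal R (I n)" "\<And>n. I n \<subseteq> I (Suc n)" for I
      using noeth that unfolding left_noetherian_def by blast
    show "surj (\<sigma> ^^ n)" for n
      using bij_fn[OF \<open>bij \<sigma>\<close>] by (rule bij_is_surj)
    show "left_ideal R ((\<sigma> ^^ n) -` top_coeffs n (J k))" for n k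
      unfolding left_ideal_def
    proof (intro conjI ballI allI)
      show "additive_subgroup ((\<sigma> ^^ n) -` top_coeffs n (J k))"
        using additive_subgroup_top_coeffs[OF sub, of n k]
        by (simp add: additive_subgroup_def pow_add)
      fix a s
      assume "a \<in> (\<sigma> ^^ n) -` top_coeffs n (J k)"
      then obtain p where p: "p \<in> J k" "degree p \<le> n" "coeff p n = (\<sigma> ^^ n) a"
        by (auto elim: top_coeffsE)
      \<comment> \<open>The constant is chosen as \<open>(\<sigma> ^^ n) s\<close> so that the new
        top coefficient is the image of \<open>rmult R s a\<close> under
        \<open>\<sigma> ^^ n\<close>.\<close>
      from ore_mult_mem_top_coeffs[OF ring degree_monom_le p(2) mult[OF p(1)], of "(\<sigma> ^^ n) s" 0]
      show "rmult R s a \<in> (\<sigma> ^^ n) -` top_coeffs n (J k)"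
        by (simp add: p pow_mult)
    qed
    show "(\<sigma> ^^ n) -` top_coeffs n (J k) \<subseteq> (\<sigma> ^^ Suc n) -` top_coeffs (Suc n) (J k)" for n k
    proof
      fix a
      assume "a \<in> (\<sigma> ^^ n) -` top_coeffs n (J k)"
      then obtain p where p: "p \<in> J k" "degree p \<le> n" "coeff p n = (\<sigma> ^^ n) a"
        by (auto elim: top_coeffsE)
      \<comment> \<open>Left multiplication by X applies \<open>\<sigma>\<close> once more to the
        top coefficient, giving \<open>(\<sigma> ^^ Suc n) a\<close>; this is why the preimages
        increase with \<open>n\<close>.\<close>
      from ore_mult_mem_top_coeffs[OF ring degree_monom_le p(2) mult[OF p(1)], of "rone R" 1]
      show "a \<in> (\<sigma> ^^ Suc n) -` top_coeffs (Suc n) (J k)"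
        using R by (simp add: p unital_ring_def)
    qed
  qed (use sub chain in auto)
qed

theorem theorem4:
  fixes R :: "'a::ab_group_add hom_ring" and \<sigma> \<delta> :: "'a \<Rightarrow> 'a"
  assumes "unital_ring R" and "hom_assoc_ring R"
    and "ring_automorphism R \<sigma>" and "skew_derivation R \<sigma> \<delta>"
    and "\<sigma> \<circ> twist R = twist R \<circ> \<sigma>" and "\<delta> \<circ> twist R = twist R \<circ> \<delta>"
  shows "(right_noetherian R \<longrightarrow> right_noetherian (ore_extension R \<sigma> \<delta>)) \<and>
         (left_noetherian R \<longrightarrow> left_noetherian (ore_extension R \<sigma> \<delta>))"
  using right_noetherian_ore_extension left_noetherian_ore_extension assms(1,3,4)
  unfolding skew_derivation_def by blast

end
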